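(* Every sublogic of $\mathbf{IL}^-(\mathbf{J1},\mathbf{J4}_+,\mathbf{J5})$ does not have the fixed point property (FPP). Furthermore, if $L$ is a logic with $\mathbf{IL}^-(\mathbf{J4}_+)\subseteq L\subseteq\mathbf{IL}^-(\mathbf{J1},\mathbf{J4}_+,\mathbf{J5})$, then $L$ does not have the Craig interpolation property (CIP).
   Context: Formulas are generated by $A ::= \bot \mid p \mid A \to A \mid \Box A \mid A \rhd A$, where $p$ ranges over a countably infinite set of propositional variables. The symbols $\neg,\land,\lor,\leftrightarrow,\top,\Diamond$ (with $\Diamond A := \neg\Box\neg A$) are the usual abbreviations. $\neg,\Box,\Diamond$ bind most strongly. $v(A)$ is the set of propositional variables contained in $A$. For a formula $A(p)$, $A(B)$ denotes the result of substituting $B$ for all occurrences of $p$ in $A(p)$. The logic $\mathbf{IL}^-$ has as axioms all instances of: $\mathbf{L1}$: all tautologies in this language; $\mathbf{L2}$: $\Box(A\to B)\to(\Box A\to\Box B)$; $\mathbf{L3}$: $\Box(\Box A\to A)\to\Box A$; $\mathbf{J3}$: $((A\rhd C)\land(B\rhd C))\to((A\lor B)\rhd C)$; $\mathbf{J6}$: $\Box A\leftrightarrow((\neg A)\rhd\bot)$. Its inference rules are Modus Ponens, Necessitation (from $A$ infer $\Box A$), $\mathbf{R1}$ (from $A\to B$ infer $(C\rhd A)\to(C\rhd B)$) and $\mathbf{R2}$ (from $A\to B$ infer $(B\rhd C)\to(A\rhd C)$). $\mathbf{IL}^-(\Sigma_1,\ldots,\Sigma_n)$ is the logic obtained from $\mathbf{IL}^-$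 by adding the schemata $\Sigma_1,\ldots,\Sigma_n$ as axiom schemata (with the same rules). $\mathbf{J1}$ is the schema $\Box(A\to B)\to(A\rhd B)$; $\mathbf{J4}_+$ is the schema $\Box(A\to B)\to((C\rhd A)\to(C\rhd B))$; $\mathbf{J5}$ is the schema $\Diamond A\rhd A$. A logic is identified with its set of theorems, and is assumed closed under Modus Ponens, Necessitation and substitution of formulas for propositional variables; $L\subseteq L'$ ($L$ is a sublogic of $L'$) means that every theorem of $L$ is a theorem of $L'$, and $L\vdash A$ means that $A$ is a theorem of $L$. A formula $A$ is modalized in $p$ if every occurrence of $p$ in $A$ is in the scope of some $\Box$ or $\rhd$. $L$ has FPP if for any propositional variable $p$ and any formula $A(p)$ which is modalized in $p$, there exists a formula $F$ such that $v(F)\subseteq v(A)\setminus\{p\}$ and $L\vdash F\leftrightarrow A(F)$. $L$ has CIP if for any formulas $A$ and $B$ with $L\vdash A\to B$, there exists a formula $C$ such that $v(C)\subseteq v(A)\cap v(B)$, $L\vdash A\to C$ and $L\vdash C\to B$. *)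

theory Defs
  imports Main
begin

datatype fm =
    Bot  ("\<^bold>\<bottom>")
  | Var nat
  | Imp fm fm  (infixr "\<^bold>\<rightarrow>" 55)
  | Box fm  ("\<^bold>\<box> _" [70] 70)
  | Rhd fm fm  (infix "\<^bold>\<rhd>" 57)

abbreviation Neg :: "fm \<Rightarrow> fm"  ("\<^bold>\<not> _" [70] 70)
  where "\<^bold>\<not> A \<equiv> A \<^bold>\<rightarrow> \<^bold>\<bottom>"

abbreviation Or :: "fm \<Rightarrow> fm \<Rightarrow> fm"  (infixr "\<^bold>\<or>" 60)
  where "A \<^bold>\<or> B \<equiv> \<^bold>\<not> A \<^bold>\<rightarrow> B"

abbreviation And :: "fm \<Rightarrow> fm \<Rightarrow> fm"  (infixr "\<^bold>\<and>" 65)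
  where "A \<^bold>\<and> B \<equiv> \<^bold>\<not> (A \<^bold>\<rightarrow> \<^bold>\<not> B)"

abbreviation Iff :: "fm \<Rightarrow> fm \<Rightarrow> fm"  (infix "\<^bold>\<leftrightarrow>" 53)
  where "A \<^bold>\<leftrightarrow> B \<equiv> (A \<^bold>\<rightarrow> B) \<^bold>\<and> (B \<^bold>\<rightarrow> A)"

abbreviation Dia :: "fm \<Rightarrow> fm"  ("\<^bold>\<diamond> _" [70] 70)
  where "\<^bold>\<diamond> A \<equiv> \<^bold>\<not> \<^bold>\<box> \<^bold>\<not> A"

primrec vars :: "fm \<Rightarrow> nat set" where
  "vars \<^bold>\<bottom> = {}"
| "vars (Var p) = {p}"
| "vars (A \<^bold>\<rightarrow> B) = vars A \<union> vars B"
| "vars (\<^bold>\<box> A) = vars A"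
| "vars (A \<^bold>\<rhd> B) = vars A \<union> vars B"

text \<open>Simultaneous substitution. For a formula \<open>A(p)\<close>, the paper's \<open>A(B)\<close> is
  \<open>subst (Var(p := B)) A\<close>.\<close>

primrec subst :: "(nat \<Rightarrow> fm) \<Rightarrow> fm \<Rightarrow> fm" where
  "subst s \<^bold>\<bottom> = \<^bold>\<bottom>"
| "subst s (Var p) = s p"
| "subst s (A \<^bold>\<rightarrow> B) = subst s A \<^bold>\<rightarrow> subst s B"
| "subst s (\<^bold>\<box> A) = \<^bold>\<box> (subst s A)"
| "subst s (A \<^bold>\<rhd> B) = subst s A \<^bold>\<rhd> subst s B"

text \<open>Boolean evaluation in which propositional variables and all formulas with a modal
  operator at the root are treated as atoms; \<open>v\<close> is only consulted on these.\<close>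

primrec bool_val :: "(fm \<Rightarrow> bool) \<Rightarrow> fm \<Rightarrow> bool" where
  "bool_val v \<^bold>\<bottom> = False"
| "bool_val v (Var p) = v (Var p)"
| "bool_val v (A \<^bold>\<rightarrow> B) = (bool_val v A \<longrightarrow> bool_val v B)"
| "bool_val v (\<^bold>\<box> A) = v (\<^bold>\<box> A)"
| "bool_val v (A \<^bold>\<rhd> B) = v (A \<^bold>\<rhd> B)"

definition tautology :: "fm \<Rightarrow> bool" where
  "tautology A \<longleftrightarrow> (\<forall>v. bool_val v A)"

text \<open>\<open>IL_minus S\<close> is the set of theorems of the extension of \<open>IL\<^sup>-\<close> by the axioms in \<open>S\<close>;
  an axiom schema is represented by the set of all its instances.\<close>

inductive_set IL_minus :: "fm set \<Rightarrow> fm set" for S :: "fm set" where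
  Ax: "A \<in> S \<Longrightarrow> A \<in> IL_minus S"
| L1: "tautology A \<Longrightarrow> A \<in> IL_minus S"
| L2: "\<^bold>\<box> (A \<^bold>\<rightarrow> B) \<^bold>\<rightarrow> (\<^bold>\<box> A \<^bold>\<rightarrow> \<^bold>\<box> B) \<in> IL_minus S"
| L3: "\<^bold>\<box> (\<^bold>\<box> A \<^bold>\<rightarrow> A) \<^bold>\<rightarrow> \<^bold>\<box> A \<in> IL_minus S"
| J3: "((A \<^bold>\<rhd> C) \<^bold>\<and> (B \<^bold>\<rhd> C)) \<^bold>\<rightarrow> ((A \<^bold>\<or> B) \<^bold>\<rhd> C) \<in> IL_minus S"
| J6: "\<^bold>\<box> A \<^bold>\<leftrightarrow> ((\<^bold>\<not> A) \<^bold>\<rhd> \<^bold>\<bottom>) \<in> IL_minus S"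
| MP: "A \<^bold>\<rightarrow> B \<in> IL_minus S \<Longrightarrow> A \<in> IL_minus S \<Longrightarrow> B \<in> IL_minus S"
| Nec: "A \<in> IL_minus S \<Longrightarrow> \<^bold>\<box> A \<in> IL_minus S"
| R1: "A \<^bold>\<rightarrow> B \<in> IL_minus S \<Longrightarrow> (C \<^bold>\<rhd> A) \<^bold>\<rightarrow> (C \<^bold>\<rhd> B) \<in> IL_minus S"
| R2: "A \<^bold>\<rightarrow> B \<in> IL_minus S \<Longrightarrow> (B \<^bold>\<rhd> C) \<^bold>\<rightarrow> (A \<^bold>\<rhd> C) \<in> IL_minus S"

definition J1 :: "fm set" where
  "J1 = {\<^bold>\<box> (A \<^bold>\<rightarrow> B) \<^bold>\<rightarrow> (A \<^bold>\<rhd> B) | A B. True}"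

definition J4_plus :: "fm set" where
  "J4_plus = {\<^bold>\<box> (A \<^bold>\<rightarrow> B) \<^bold>\<rightarrow> ((C \<^bold>\<rhd> A) \<^bold>\<rightarrow> (C \<^bold>\<rhd> B)) | A B C. True}"

definition J5 :: "fm set" where
  "J5 = {(\<^bold>\<diamond> A) \<^bold>\<rhd> A | A. True}"

text \<open>Beyond the three closure conditions nothing is required of a logic: it need not contain
  any particular axioms, nor be closed under \<open>R1\<close> and \<open>R2\<close>.\<close>

definition is_logic :: "fm set \<Rightarrow> bool" where
  "is_logic L \<longleftrightarrow>
     (\<forall>A B. A \<^bold>\<rightarrow> B \<in> L \<longrightarrow> A \<in> L \<longrightarrow> B \<in> L) \<and>
     (\<forall>A. A \<in> L \<longrightarrow> \<^bold>\<box> A \<in> L) \<and>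
     (\<forall>s A. A \<in> L \<longrightarrow> subst s A \<in> L)"

primrec modalized :: "nat \<Rightarrow> fm \<Rightarrow> bool" where
  "modalized p \<^bold>\<bottom> = True"
| "modalized p (Var q) = (q \<noteq> p)"
| "modalized p (A \<^bold>\<rightarrow> B) = (modalized p A \<and> modalized p B)"
| "modalized p (\<^bold>\<box> A) = True"
| "modalized p (A \<^bold>\<rhd> B) = True"

definition FPP :: "fm set \<Rightarrow> bool" where
  "FPP L \<longleftrightarrow> (\<forall>p A. modalized p A \<longrightarrow>
     (\<exists>F. vars F \<subseteq> vars A - {p} \<and> F \<^bold>\<leftrightarrow> subst (Var(p := F)) A \<in> L))"

definition CIP :: "fm set \<Rightarrow> bool" where
  "CIP L \<longleftrightarrow> (\<forall>A B. A \<^bold>\<rightarrow> B \<in> L \<longrightarrow>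
     (\<exists>C. vars C \<subseteq> vars A \<inter> vars B \<and> A \<^bold>\<rightarrow> C \<in> L \<and> C \<^bold>\<rightarrow> B \<in> L))"

end

theory Submission
  imports Defs
begin

text \<open>In the Veltman-style frame on the natural numbers where \<open>R\<close> is \<open>>\<close> and \<open>S\<^sub>n\<close> is \<open>\<ge>\<close> below
  \<open>n\<close> together with the single extra pair \<open>(0, n - 1)\<close>, every closed formula has an eventually
  constant truth value, whereas any solution of \<open>p \<leftrightarrow> (\<top> \<rhd> \<not> p)\<close> alternates. So this formula has
  no closed fixed point in a logic that is sound for the frame. By Loeb's rule the solution is
  provably unique in \<open>IL\<^sup>-(J4\<^sub>+)\<close>, and an interpolant of this uniqueness statement, written with two
  different variables, would be a closed formula that alternates as well.\<close>

primrec sat :: "(nat \<Rightarrow> nat \<Rightarrow> bool) \<Rightarrow> nat \<Rightarrow> fm \<Rightarrow> bool" where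
  "sat V n \<^bold>\<bottom> = False"
| "sat V n (Var p) = V p n"
| "sat V n (A \<^bold>\<rightarrow> B) = (sat V n A \<longrightarrow> sat V n B)"
| "sat V n (\<^bold>\<box> A) = (\<forall>m<n. sat V m A)"
| "sat V n (A \<^bold>\<rhd> B) =
     (\<forall>m<n. sat V m A \<longrightarrow> (\<exists>k\<le>m. sat V k B) \<or> m = 0 \<and> sat V (n - 1) B)"

lemma sat_eq_bool_val: "sat V n A = bool_val (sat V n) A"
  by (induction A) auto

text \<open>\<open>L3\<close> holds because \<open><\<close> is well-founded, \<open>J1\<close>
  because each \<open>S\<^sub>n\<close> is reflexive below \<open>n\<close>, and \<open>J5\<close>
  because \<open>S\<^sub>n\<close> contains \<open>>\<close> below \<open>n\<close>.\<close>

lemma IL_minus_sound: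
  assumes "A \<in> IL_minus (J1 \<union> J4_plus \<union> J5)"
  shows "sat V n A"
  using assms
proof (induction arbitrary: n rule: IL_minus.induct)
  case (Ax A)
  then consider "A \<in> J1" | "A \<in> J4_plus" | "A \<in> J5" by blast
  then show ?case
  proof cases
    case 1
    then show ?thesis by (fastforce simp: J1_def)
  next
    case 2
    then obtain B C D where A: "A = \<^bold>\<box> (B \<^bold>\<rightarrow> C) \<^bold>\<rightarrow> (D \<^bold>\<rhd> B \<^bold>\<rightarrow> D \<^bold>\<rhd> C)"
      by (auto simp: J4_plus_def)
    \<comment> \<open>Both kinds of witness stay below \<open>n\<close>: \<open>k\<close> because
      \<open>k \<le> m < n\<close>, and \<open>n - 1\<close> because \<open>m < n\<close> makes
      \<open>n\<close> positive. So the boxed implication applies to either.\<close>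
    have "(\<exists>k\<le>m. sat V k C) \<or> m = 0 \<and> sat V (n - 1) C"
      if "\<forall>k<n. sat V k B \<longrightarrow> sat V k C" "m < n"
         "(\<exists>k\<le>m. sat V k B) \<or> m = 0 \<and> sat V (n - 1) B" for m
      using that by (metis diff_less le_less_trans less_one not_gr_zero not_less0)
    then show ?thesis unfolding A sat.simps by blast
  next
    case 3
    then show ?thesis by (fastforce simp: J5_def intro: less_imp_le)
  qed
next
  case (L1 A)
  then show ?case by (metis sat_eq_bool_val tautology_def)
next
  case (L3 A)
  have "sat V m A" if "\<forall>m<n. (\<forall>k<m. sat V k A) \<longrightarrow> sat V m A" "m < n" for m
    using that(2) by (induction m rule: less_induct) (meson less_trans that(1))
  then show ?case by simp
next
  case (R1 A B C)
  then show ?case by (simp, blast)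
next
  case (L2 A B)
  show ?case by simp
next
  case (J3 A C B)
  show ?case by (simp, blast)
next
  case (J6 A)
  show ?case by auto
next
  case (MP A B)
  then show ?case by simp
next
  case (Nec A)
  then show ?case by simp
next
  case (R2 A B C)
  then show ?case by auto
qed

text \<open>Boxed formulas can only switch from true to false as \<open>n\<close> grows. So can
  \<open>\<rhd>\<close>, once the value of its right argument at \<open>n - 1\<close> has
  settled.\<close>

lemma closed_eventually_constant:
  assumes "vars A = {}"
  shows "\<exists>N b. \<forall>n\<ge>N. sat V n A = b"
  using assms
proof (induction A)
  case (Imp A B)
  then obtain M N a b where "\<forall>n\<ge>M. sat V n A = a" "\<forall>n\<ge>N. sat V n B = b"
    by auto
  then have "\<forall>n\<ge>max M N. sat V n (A \<^bold>\<rightarrow> B) = (a \<longrightarrow> b)"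
    by simp
  then show ?case by blast
next
  case (Box A)
  show ?case
  proof (cases "\<forall>n. sat V n (\<^bold>\<box> A)")
    case True
    then show ?thesis by blast
  next
    case False
    then obtain N where "\<not> sat V N (\<^bold>\<box> A)" by blast
    then have "\<forall>n\<ge>N. \<not> sat V n (\<^bold>\<box> A)" by (auto intro: less_le_trans)
    then show ?thesis by blast
  qed
next
  case (Rhd A B)
  then obtain N b where N: "\<forall>n\<ge>N. sat V n B = b" by auto
  \<comment> \<open>\<open>good\<close> replaces \<open>sat V (n - 1) B\<close> by the limit value
    \<open>b\<close>, which removes the dependence on \<open>n\<close>. Strictness in
    \<open>n > N\<close> ensures \<open>n - 1 \<ge> N\<close>.\<close>
  define good where
    "good m \<longleftrightarrow> (sat V m A \<longrightarrow> (\<exists>k\<le>m. sat V k B) \<or> m = 0 \<and> b)" for m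
  have *: "sat V n (A \<^bold>\<rhd> B) \<longleftrightarrow> (\<forall>m<n. good m)" if "n > N" for n
    using N that by (auto simp: good_def)
  show ?case
  proof (cases "\<forall>m. good m")
    case True
    then have "\<forall>n\<ge>Suc N. sat V n (A \<^bold>\<rhd> B)" using * by simp
    then show ?thesis by blast
  next
    case False
    then obtain m where m: "\<not> good m" by blast
    have "\<forall>n\<ge>Suc (max m N). \<not> sat V n (A \<^bold>\<rhd> B)"
    proof (intro allI impI)
      fix n assume "n \<ge> Suc (max m N)"
      then have "n > N" "m < n" by auto
      then show "\<not> sat V n (A \<^bold>\<rhd> B)" using m *[of n] by blast
    qed
    then show ?thesis by blast
  qed
qed auto

abbreviation Top_rhd_Neg :: "fm \<Rightarrow> fm" where
  "Top_rhd_Neg A \<equiv> (\<^bold>\<not> \<^bold>\<bottom>) \<^bold>\<rhd> (\<^bold>\<not> A)"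

text \<open>World 0 satisfies \<open>A\<close> vacuously and world 1 refutes it. Hence every
  \<open>m \<ge> 1\<close> has the witness 1 for the negation of \<open>A\<close>, while
  \<open>m = 0\<close> can rely only on the extra pair, that is, on \<open>A\<close> failing at the
  predecessor of \<open>n\<close>.\<close>

lemma fixed_point_alternates:
  assumes fixp: "\<And>n. sat V n A = sat V n (Top_rhd_Neg A)"
  shows "sat V (Suc (Suc n)) A \<longleftrightarrow> \<not> sat V (Suc n) A"
proof -
  have 0: "sat V 0 A" using fixp[of 0] by simp
  have 1: "\<not> sat V (Suc 0) A" using fixp[of "Suc 0"] 0 by simp
  have "(\<exists>k\<le>m. \<not> sat V k A) \<longleftrightarrow> m \<noteq> 0" for m
    using 0 1 by (cases m) auto
  then show ?thesis using fixp[of "Suc (Suc n)"] by auto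
qed

lemma no_closed_fixed_point:
  assumes "vars A = {}"
  shows "\<not> (\<forall>n. sat V n A = sat V n (Top_rhd_Neg A))"
proof
  assume "\<forall>n. sat V n A = sat V n (Top_rhd_Neg A)"
  then have alt: "sat V (Suc (Suc n)) A \<longleftrightarrow> \<not> sat V (Suc n) A" for n
    by (intro fixed_point_alternates) blast
  obtain N b where "\<forall>n\<ge>N. sat V n A = b"
    using closed_eventually_constant[OF assms] by blast
  then have "sat V (Suc N) A = b" "sat V (Suc (Suc N)) A = b"
    by simp_all
  then show False using alt[of N] by simp
qed

lemma sublogic_not_FPP:
  assumes "L \<subseteq> IL_minus (J1 \<union> J4_plus \<union> J5)"
  shows "\<not> FPP L"
proof
  assume "FPP L"
  moreover have "modalized 0 (Top_rhd_Neg (Var 0))" by simp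
  ultimately obtain F where
    F: "vars F \<subseteq> vars (Top_rhd_Neg (Var 0)) - {0}"
       "F \<^bold>\<leftrightarrow> subst (Var(0 := F)) (Top_rhd_Neg (Var 0)) \<in> L"
    unfolding FPP_def by blast
  have "sat (\<lambda>_ _. False) n (F \<^bold>\<leftrightarrow> Top_rhd_Neg F)" for n
    using IL_minus_sound[OF subsetD[OF assms F(2)]] by (simp del: sat.simps)
  then have "\<forall>n. sat (\<lambda>_ _. False) n F = sat (\<lambda>_ _. False) n (Top_rhd_Neg F)"
    by (simp only: sat.simps) blast
  moreover have "vars F = {}" using F(1) by simp
  ultimately show False using no_closed_fixed_point by blast
qed

lemma IL_minus_taut_MP2:
  assumes "A \<in> IL_minus S" "B \<in> IL_minus S" "tautology (A \<^bold>\<rightarrow> B \<^bold>\<rightarrow> C)"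
  shows "C \<in> IL_minus S"
  using assms by (blast intro: IL_minus.MP IL_minus.L1)

lemma IL_minus_Box_mono:
  assumes "A \<^bold>\<rightarrow> B \<in> IL_minus S"
  shows "\<^bold>\<box> A \<^bold>\<rightarrow> \<^bold>\<box> B \<in> IL_minus S"
  using assms by (blast intro: IL_minus.MP IL_minus.L2 IL_minus.Nec)

text \<open>Boxing the premise and applying \<open>L3\<close> gives \<open>\<box> E\<close> from
  \<open>\<box> K\<close>; the premise itself then yields \<open>E\<close>.\<close>

lemma IL_minus_Loeb_rule:
  assumes "K \<^bold>\<rightarrow> (\<^bold>\<box> E \<^bold>\<rightarrow> E) \<in> IL_minus S"
  shows "(\<^bold>\<box> K \<^bold>\<and> K) \<^bold>\<rightarrow> E \<in> IL_minus S"
proof -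
  have "\<^bold>\<box> K \<^bold>\<rightarrow> \<^bold>\<box> E \<in> IL_minus S"
    by (rule IL_minus_taut_MP2[OF IL_minus_Box_mono[OF assms] IL_minus.L3[of E]])
       (simp add: tautology_def)
  then show ?thesis
    by (rule IL_minus_taut_MP2[OF assms]) (simp add: tautology_def)
qed

lemma IL_minus_Box_And: "\<^bold>\<box> A \<^bold>\<rightarrow> \<^bold>\<box> B \<^bold>\<rightarrow> \<^bold>\<box> (A \<^bold>\<and> B) \<in> IL_minus S"
proof -
  have "A \<^bold>\<rightarrow> B \<^bold>\<rightarrow> A \<^bold>\<and> B \<in> IL_minus S"
    by (rule IL_minus.L1) (simp add: tautology_def)
  then show ?thesis
    by (rule IL_minus_taut_MP2[OF IL_minus_Box_mono IL_minus.L2[of B "A \<^bold>\<and> B"]]) (simp add: tautology_def)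
qed

text \<open>\<open>A\<close> and \<open>B\<close> occur only to the right of \<open>\<rhd>\<close>,
  where \<open>J4_plus\<close> permits replacement under a box.\<close>

lemma Box_imp_Top_rhd_Neg:
  assumes "J4_plus \<subseteq> S" "tautology (E \<^bold>\<rightarrow> (\<^bold>\<not> A \<^bold>\<rightarrow> \<^bold>\<not> B))"
  shows "\<^bold>\<box> E \<^bold>\<rightarrow> (Top_rhd_Neg A \<^bold>\<rightarrow> Top_rhd_Neg B) \<in> IL_minus S"
proof -
  have "\<^bold>\<box> (\<^bold>\<not> A \<^bold>\<rightarrow> \<^bold>\<not> B) \<^bold>\<rightarrow> (Top_rhd_Neg A \<^bold>\<rightarrow> Top_rhd_Neg B) \<in> IL_minus S"
    using assms(1) by (intro IL_minus.Ax) (auto simp: J4_plus_def)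
  then show ?thesis
    by (rule IL_minus_taut_MP2[OF IL_minus_Box_mono[OF IL_minus.L1[OF assms(2)]]])
       (simp add: tautology_def)
qed

text \<open>Given both fixed point equations, a boxed equivalence of \<open>A\<close> and
  \<open>B\<close> implies the equivalence itself, so the Loeb rule applies. The result is arranged
  with \<open>A\<close> alone on the left and \<open>B\<close> alone on the right, ready for
  interpolation.\<close>

lemma fixed_point_unique:
  fixes A B :: fm
  defines "a \<equiv> A \<^bold>\<leftrightarrow> Top_rhd_Neg A" and "b \<equiv> B \<^bold>\<leftrightarrow> Top_rhd_Neg B"
  assumes "J4_plus \<subseteq> S"
  shows "(\<^bold>\<box> a \<^bold>\<and> a \<^bold>\<and> A) \<^bold>\<rightarrow> (\<^bold>\<box> b \<^bold>\<and> b \<^bold>\<rightarrow> B) \<in> IL_minus S"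
proof -
  define E where "E = (A \<^bold>\<leftrightarrow> B)"
  have "(a \<^bold>\<and> b) \<^bold>\<rightarrow> (\<^bold>\<box> E \<^bold>\<rightarrow> E) \<in> IL_minus S"
    by (rule IL_minus_taut_MP2[OF Box_imp_Top_rhd_Neg[OF assms(3), of E A B]
          Box_imp_Top_rhd_Neg[OF assms(3), of E B A]])
       (simp only: tautology_def E_def a_def b_def bool_val.simps, blast)+
  then have "(\<^bold>\<box> (a \<^bold>\<and> b) \<^bold>\<and> (a \<^bold>\<and> b)) \<^bold>\<rightarrow> E \<in> IL_minus S"
    by (rule IL_minus_Loeb_rule)
  then show ?thesis
    by (rule IL_minus_taut_MP2[OF _ IL_minus_Box_And[of a b]]) (simp only: tautology_def E_def bool_val.simps, blast)
qed

text \<open>This supplies an actual solution in the frame, so that the uniqueness statement is not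
  satisfied vacuously there.\<close>

lemma even_fixed_point:
  "sat (\<lambda>_. even) n (Var p) = sat (\<lambda>_. even) n (Top_rhd_Neg (Var p))"
proof -
  have "(\<exists>k\<le>m. odd k) \<longleftrightarrow> m \<noteq> 0" for m :: nat
    by (metis even_zero le_zero_eq less_one not_le odd_one)
  then show ?thesis
    by (cases n) auto
qed

lemma intermediate_logic_not_CIP:
  assumes "IL_minus J4_plus \<subseteq> L" "L \<subseteq> IL_minus (J1 \<union> J4_plus \<union> J5)"
  shows "\<not> CIP L"
proof
  assume "CIP L"
  define a where "a p = (Var p \<^bold>\<leftrightarrow> Top_rhd_Neg (Var p))" for p
  have "(\<^bold>\<box> a 0 \<^bold>\<and> a 0 \<^bold>\<and> Var 0) \<^bold>\<rightarrow> (\<^bold>\<box> a 1 \<^bold>\<and> a 1 \<^bold>\<rightarrow> Var 1) \<in> L"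
    unfolding a_def by (rule subsetD[OF assms(1) fixed_point_unique[OF order_refl]])
  with \<open>CIP L\<close> obtain C where
    vars: "vars C \<subseteq> vars (\<^bold>\<box> a 0 \<^bold>\<and> a 0 \<^bold>\<and> Var 0) \<inter> vars (\<^bold>\<box> a 1 \<^bold>\<and> a 1 \<^bold>\<rightarrow> Var 1)" and
    C: "(\<^bold>\<box> a 0 \<^bold>\<and> a 0 \<^bold>\<and> Var 0) \<^bold>\<rightarrow> C \<in> L" "C \<^bold>\<rightarrow> (\<^bold>\<box> a 1 \<^bold>\<and> a 1 \<^bold>\<rightarrow> Var 1) \<in> L"
    unfolding CIP_def by blast
  have closed: "vars C = {}"
    using vars by (auto simp: a_def)
  define V where "V = (\<lambda>(_ :: nat) n :: nat. even n)"
  have a: "sat V n (a p)" for n p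
    unfolding a_def V_def using even_fixed_point[of n p] by (simp only: sat.simps) blast
  \<comment> \<open>Under \<open>V\<close> all \<open>a p\<close> hold at every world, so
    \<open>C\<close> is squeezed between \<open>Var 0\<close> and \<open>Var 1\<close>, both true
    exactly at the even worlds.\<close>
  have sat_C: "sat V n C \<longleftrightarrow> even n" for n
    using C[THEN subsetD[OF assms(2)], THEN IL_minus_sound, of V n] a by (auto simp: V_def)
  obtain N b where "\<forall>n\<ge>N. sat V n C = b"
    using closed_eventually_constant[OF closed] by blast
  then have "sat V (Suc N) C = b" "sat V (Suc (Suc N)) C = b"
    by simp_all
  then show False using sat_C even_Suc by blast
qed

theorem corollary6p6:
  shows "(\<forall>L. is_logic L \<and> L \<subseteq> IL_minus (J1 \<union> J4_plus \<union> J5) \<longrightarrow> \<not> FPP L) \<and>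
         (\<forall>L. is_logic L \<and> IL_minus J4_plus \<subseteq> L \<and> L \<subseteq> IL_minus (J1 \<union> J4_plus \<union> J5)
            \<longrightarrow> \<not> CIP L)"
  using sublogic_not_FPP intermediate_logic_not_CIP by blast

end
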